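(* Consider a market for a single risky asset ($K=1$) with non-constant payoff $S:D\to\mathbb{R}$ on a state space with $|D|=2$, with $\underline S=\min_{s\in D}S_s$, $\overline S=\max_{s\in D}S_s$, supply $\theta_0=0$, and $m\ge2$ investors indexed by $\mathcal I=\{1,\dots,m\}$. Assume $\alpha_1<1/2$ and $\alpha_i\ge1/2$ for all $i\in\mathcal I$, $i>1$. Assume further that all investors have the same initial (reference) probability measure $\mathbb{P}_0$, divergence parameter $c$, utility function $u$ and initial wealth $w_0$. Then a sufficient condition for the existence of a non-zero second-best Pareto-optimal equilibrium price $\tilde\pi\in(\underline S,\overline S)$ is $$\alpha_1+\min_{i\in\mathcal I\setminus\{1\}}\alpha_i<1 .$$
   Context: $\mathbb{P}_0=(p_{0s})_{s\in D}$ has all $p_{0s}>0$; $c\ge1$ satisfies $c<\min_{s\in D}\frac1{1-p_{0s}}$; $\alpha_i\in[0,1]$; $u$ is strictly concave and twice differentiable. At price $\pi$, investor $i$'s objective is $$V_{\alpha_i}(\theta)=\alpha_i\min_{P\in\mathcal{X}}\mathbb{E}_P[u(w_0+\theta(S-\pi))]+(1-\alpha_i)\max_{P\in\mathcal{X}}\mathbb{E}_P[u(w_0+\theta(S-\pi))],$$ with $\mathcal{X}=\{P: P(s)\ge 0\ \forall s\in D,\ \sum_{s}P(s)=1,\ \sum_{s}P(s)^2/p_{0s}\le c\}$. The admissible set of positions is $\Theta=\mathbb{R}$ if $u$ is defined on all of $\mathbb{R}$; if $u$ is defined only for positive wealth, then $w_0>0$ and $\Theta=\{\theta\in\mathbb{R}: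 w_0+\theta(S_s-\pi)>0\ \forall s\in D\}$. $\mathbb{E}_0$ denotes expectation under $\mathbb{P}_0$. Second-best Pareto-optimal equilibrium price: a price $\tilde\pi$ such that $\sum_{i\in\mathcal I}\tilde\theta_i(\tilde\pi)+\theta_0=0$, where for $\alpha_i\ge1/2$, $\tilde\theta_i(\pi)$ is the optimal demand, i.e. the maximizer of $V_{\alpha_i}$ over $\Theta$ at price $\pi$, and for $\alpha_i<1/2$, $$\tilde\theta_i(\pi)=\begin{cases}\operatorname{arg\,max}_{\theta\in\Theta,\,\theta\le0}V_{\alpha_i}(\theta), & \mathbb{E}_0[S]\ge\pi,\\ \operatorname{arg\,max}_{\theta\in\Theta,\,\theta\ge0}V_{\alpha_i}(\theta), & \mathbb{E}_0[S]<\pi.\end{cases}$$ It is called non-zero if the positions $\tilde\theta_i(\tilde\pi)$, $i\in\mathcal I$, are not all zero.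
   Formalization: The formal theorem assumes c>1 rather than c≥1, that u'(w_0)>0, and that each investor's optimal (second-best) demand exists at every price in (min S, max S); without these assumptions the claim can fail. *)

theory Defs
  imports "HOL-Analysis.Analysis"
begin

definition strictly_concave_on :: "real set \<Rightarrow> (real \<Rightarrow> real) \<Rightarrow> bool" where
  "strictly_concave_on W u \<longleftrightarrow>
     (\<forall>x\<in>W. \<forall>y\<in>W. \<forall>t. x \<noteq> y \<and> 0 < t \<and> t < 1 \<longrightarrow>
        u ((1 - t) * x + t * y) > (1 - t) * u x + t * u y)"

definition expectation :: "('s::finite \<Rightarrow> real) \<Rightarrow> ('s \<Rightarrow> real) \<Rightarrow> real" where
  "expectation P X = (\<Sum>s\<in>UNIV. P s * X s)"

definition plausible_probs :: "('s::finite \<Rightarrow> real) \<Rightarrow> real \<Rightarrow> ('s \<Rightarrow> real) set" where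
  "plausible_probs p0 c =
     {P. (\<forall>s. P s \<ge> 0) \<and> (\<Sum>s\<in>UNIV. P s) = 1 \<and> (\<Sum>s\<in>UNIV. (P s)\<^sup>2 / p0 s) \<le> c}"

text \<open>For positive \<open>p0\<close> the set of plausible probabilities is compact, and expectation is continuous
  in the probability, so over a nonempty set the infimum and supremum below are attained: they are
  the minimum and the maximum.\<close>

definition objective ::
  "(real \<Rightarrow> real) \<Rightarrow> real \<Rightarrow> ('s::finite \<Rightarrow> real) \<Rightarrow> real \<Rightarrow> ('s \<Rightarrow> real) \<Rightarrow> real \<Rightarrow> real \<Rightarrow> real \<Rightarrow> real"
where
  "objective u w0 p0 c S a \<pi> \<theta> =
     a * (INF P\<in>plausible_probs p0 c. expectation P (\<lambda>s. u (w0 + \<theta> * (S s - \<pi>)))) +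
     (1 - a) * (SUP P\<in>plausible_probs p0 c. expectation P (\<lambda>s. u (w0 + \<theta> * (S s - \<pi>))))"

text \<open>\<open>W\<close> is the set of wealth levels on which the utility function is defined, either \<open>UNIV\<close>
  or \<open>{0<..}\<close>.\<close>

definition admissible :: "real set \<Rightarrow> real \<Rightarrow> ('s \<Rightarrow> real) \<Rightarrow> real \<Rightarrow> real set" where
  "admissible W w0 S \<pi> = {\<theta>. \<forall>s. w0 + \<theta> * (S s - \<pi>) \<in> W}"

definition second_best_admissible ::
  "real set \<Rightarrow> real \<Rightarrow> ('s::finite \<Rightarrow> real) \<Rightarrow> ('s \<Rightarrow> real) \<Rightarrow> real \<Rightarrow> real \<Rightarrow> real set"
where
  "second_best_admissible W w0 p0 S a \<pi> =
     (if a \<ge> 1/2 then admissible W w0 S \<pi>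
      else if expectation p0 S \<ge> \<pi> then admissible W w0 S \<pi> \<inter> {..0}
      else admissible W w0 S \<pi> \<inter> {0..})"

definition second_best_demand ::
  "real set \<Rightarrow> (real \<Rightarrow> real) \<Rightarrow> real \<Rightarrow> ('s::finite \<Rightarrow> real) \<Rightarrow> real \<Rightarrow> ('s \<Rightarrow> real) \<Rightarrow> real \<Rightarrow> real \<Rightarrow> real set"
where
  "second_best_demand W u w0 p0 c S a \<pi> =
     {\<theta>. is_arg_max (objective u w0 p0 c S a \<pi>)
           (\<lambda>\<theta>. \<theta> \<in> second_best_admissible W w0 p0 S a \<pi>) \<theta>}"

text \<open>The singleton requirement says that \<open>\<theta> i\<close> is \<^emph>\<open>the\<close> (existing and unique) maximiser
  for investor \<open>i\<close>, so that the positions are determined by the price.\<close>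

definition second_best_positions ::
  "real set \<Rightarrow> (real \<Rightarrow> real) \<Rightarrow> real \<Rightarrow> ('s::finite \<Rightarrow> real) \<Rightarrow> real \<Rightarrow> ('s \<Rightarrow> real) \<Rightarrow>
   nat set \<Rightarrow> (nat \<Rightarrow> real) \<Rightarrow> real \<Rightarrow> (nat \<Rightarrow> real) \<Rightarrow> bool"
where
  "second_best_positions W u w0 p0 c S I \<alpha> \<pi> \<theta> \<longleftrightarrow>
     (\<forall>i\<in>I. second_best_demand W u w0 p0 c S (\<alpha> i) \<pi> = {\<theta> i})"

definition nonzero_second_best_equilibrium_price ::
  "real set \<Rightarrow> (real \<Rightarrow> real) \<Rightarrow> real \<Rightarrow> ('s::finite \<Rightarrow> real) \<Rightarrow> real \<Rightarrow> ('s \<Rightarrow> real) \<Rightarrow>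
   nat set \<Rightarrow> (nat \<Rightarrow> real) \<Rightarrow> real \<Rightarrow> real \<Rightarrow> bool"
where
  "nonzero_second_best_equilibrium_price W u w0 p0 c S I \<alpha> \<theta>0 \<pi> \<longleftrightarrow>
     (\<exists>\<theta>. second_best_positions W u w0 p0 c S I \<alpha> \<pi> \<theta> \<and>
          (\<Sum>i\<in>I. \<theta> i) + \<theta>0 = 0 \<and> (\<exists>i\<in>I. \<theta> i \<noteq> 0))"

text \<open>Every investor has some optimal position at every price strictly between the extreme
  payoffs. Strict concavity alone does not give this: if \<open>u'\<close> ranges over a bounded interval
  away from 0, the supremum of the objective need not be attained.\<close>

definition demands_exist ::
  "real set \<Rightarrow> (real \<Rightarrow> real) \<Rightarrow> real \<Rightarrow> ('s::finite \<Rightarrow> real) \<Rightarrow> real \<Rightarrow> ('s \<Rightarrow> real) \<Rightarrow>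
   nat set \<Rightarrow> (nat \<Rightarrow> real) \<Rightarrow> bool"
where
  "demands_exist W u w0 p0 c S I \<alpha> \<longleftrightarrow>
     (\<forall>\<pi>. Min (range S) < \<pi> \<and> \<pi> < Max (range S) \<longrightarrow>
        (\<forall>i\<in>I. second_best_demand W u w0 p0 c S (\<alpha> i) \<pi> \<noteq> {}))"

end

theory Submission
  imports Defs
begin

text \<open>In two states the plausible probabilities of the high payoff form an interval
  \<open>[p - r, p + r]\<close> inside \<open>(0, 1)\<close>, so an investor with \<open>\<alpha> \<ge> 1/2\<close> maximises the minimum, and one with
  \<open>\<alpha> < 1/2\<close> the maximum, of the expected utilities under the two weights \<open>p \<plusminus> (2\<alpha> - 1) r\<close>.
  The former hold nothing while the price lies between the two corresponding mean payoffs and go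
  short above them; investor 1, above the reference mean, effectively uses the single weight
  \<open>p + (1 - 2\<alpha>) r\<close> and is long until the price reaches its mean payoff.
  The condition says that the first of the other investors to go short does so at a price \<open>\<pi>0\<close>
  below the price \<open>\<pi>1\<close> at which investor 1 stops buying. Total demand is positive just above \<open>\<pi>0\<close>,
  negative at \<open>\<pi>1\<close>, and continuous in between.\<close>

section \<open>Maximisers of strictly quasiconcave functions on the line\<close>

text \<open>A one-dimensional maximum theorem. At the maximiser \<open>F\<close> is strictly larger
  than at distance \<open>d\<close> on either side. These two strict inequalities survive small
  changes of the parameter, and quasiconcavity then traps the new maximiser between the two
  comparison points. Continuity in the parameter at fixed positions thus replaces a compactness
  argument.\<close>

lemma continuous_on_argmax:
  fixes F :: "real \<Rightarrow> real \<Rightarrow> real" and A :: "real \<Rightarrow> real set" and \<theta> :: "real \<Rightarrow> real"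
  assumes argmax: "\<And>\<pi>. \<pi> \<in> T \<Longrightarrow> is_arg_max (F \<pi>) (\<lambda>x. x \<in> A \<pi>) (\<theta> \<pi>)"
    and quasiconcave: "\<And>\<pi> x y z. \<pi> \<in> T \<Longrightarrow> x \<in> A \<pi> \<Longrightarrow> y \<in> A \<pi> \<Longrightarrow> x < z \<Longrightarrow> z < y \<Longrightarrow>
           min (F \<pi> x) (F \<pi> y) < F \<pi> z"
    and open_A: "\<And>\<pi>. \<pi> \<in> T \<Longrightarrow> open (A \<pi>)"
    and persists: "\<And>\<pi> x. \<pi> \<in> T \<Longrightarrow> x \<in> A \<pi> \<Longrightarrow> \<forall>\<^sub>F \<pi>' in at \<pi> within T. x \<in> A \<pi>'"
    and tendsto: "\<And>\<pi> x. \<pi> \<in> T \<Longrightarrow> x \<in> A \<pi> \<Longrightarrow> ((\<lambda>\<pi>'. F \<pi>' x) \<longlongrightarrow> F \<pi> x) (at \<pi> within T)"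
  shows "continuous_on T \<theta>"
  unfolding continuous_on_def
proof
  fix \<pi> assume \<pi>: "\<pi> \<in> T"
  have max: "F \<pi>' y \<le> F \<pi>' (\<theta> \<pi>')" "\<theta> \<pi>' \<in> A \<pi>'" if "\<pi>' \<in> T" "y \<in> A \<pi>'" for \<pi>' y
    using argmax[OF that(1)] that(2) by (auto simp: is_arg_max_def not_less)
  have \<theta>A: "\<theta> \<pi> \<in> A \<pi>" using argmax[OF \<pi>] by (auto simp: is_arg_max_def)
  show "(\<theta> \<longlongrightarrow> \<theta> \<pi>) (at \<pi> within T)"
  proof (rule tendstoI)
    fix e :: real assume "0 < e"
    obtain r where r: "0 < r" "ball (\<theta> \<pi>) r \<subseteq> A \<pi>"
      using open_A[OF \<pi>] \<theta>A by (meson open_contains_ball)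
    define d where "d = min e r / 2"
    have d: "0 < d" "d < e" "d < r" using \<open>0 < e\<close> r by (auto simp: d_def min_def)
    let ?a = "\<theta> \<pi> - d" and ?b = "\<theta> \<pi> + d"
    have mem: "?a \<in> A \<pi>" "?b \<in> A \<pi>" using r d by (auto simp: dist_real_def subset_iff)
    have half: "\<theta> \<pi> - d/2 \<in> A \<pi>" "\<theta> \<pi> + d/2 \<in> A \<pi>"
      using r d by (auto simp: dist_real_def subset_iff)
    \<comment> \<open>The point halfway to the maximiser beats the smaller of the two end values
      without exceeding the maximum, so the inequality is strict.\<close>
    have below: "F \<pi> ?a < F \<pi> (\<theta> \<pi>)"
      using quasiconcave[OF \<pi> mem(1) \<theta>A, of "\<theta> \<pi> - d/2"] max[OF \<pi> half(1)] max[OF \<pi> mem(1)] d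
      by (auto simp: min_def split: if_splits)
    have above: "F \<pi> ?b < F \<pi> (\<theta> \<pi>)"
      using quasiconcave[OF \<pi> \<theta>A mem(2), of "\<theta> \<pi> + d/2"] max[OF \<pi> half(2)] max[OF \<pi> mem(2)] d
      by (auto simp: min_def split: if_splits)
    have "\<forall>\<^sub>F \<pi>' in at \<pi> within T. 0 < F \<pi>' (\<theta> \<pi>) - F \<pi>' ?a"
      using order_tendstoD(1)[OF tendsto_diff[OF tendsto[OF \<pi> \<theta>A] tendsto[OF \<pi> mem(1)]], of 0] below
      by simp
    moreover have "\<forall>\<^sub>F \<pi>' in at \<pi> within T. 0 < F \<pi>' (\<theta> \<pi>) - F \<pi>' ?b"
      using order_tendstoD(1)[OF tendsto_diff[OF tendsto[OF \<pi> \<theta>A] tendsto[OF \<pi> mem(2)]], of 0] above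
      by simp
    moreover have "\<forall>\<^sub>F \<pi>' in at \<pi> within T. \<pi>' \<in> T" by (simp add: eventually_at_filter)
    ultimately show "\<forall>\<^sub>F \<pi>' in at \<pi> within T. dist (\<theta> \<pi>') (\<theta> \<pi>) < e"
      using persists[OF \<pi> \<theta>A] persists[OF \<pi> mem(1)] persists[OF \<pi> mem(2)]
    proof eventually_elim
      case (elim \<pi>')
      note le = max(1)[OF elim(3) elim(4)] and \<theta>'A = max(2)[OF elim(3) elim(4)]
      \<comment> \<open>A new maximiser to the left of \<open>?a\<close> would leave
        \<open>?a\<close> between it and \<open>\<theta> \<pi>\<close>, so by quasiconcavity
        \<open>?a\<close> would beat the worse of these two, namely
        \<open>\<theta> \<pi>\<close>.\<close>
      have "?a < \<theta> \<pi>'"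
      proof (rule ccontr)
        assume "\<not> ?a < \<theta> \<pi>'"
        then consider "\<theta> \<pi>' = ?a" | "\<theta> \<pi>' < ?a" by linarith
        then show False
          using le elim(1) quasiconcave[OF elim(3) \<theta>'A elim(4), of ?a] d
          by cases (auto simp: min_def split: if_splits)
      qed
      moreover have "\<theta> \<pi>' < ?b"
      proof (rule ccontr)
        assume "\<not> \<theta> \<pi>' < ?b"
        then consider "\<theta> \<pi>' = ?b" | "?b < \<theta> \<pi>'" by linarith
        then show False
          using le elim(2) quasiconcave[OF elim(3) elim(4) \<theta>'A, of ?b] d
          by cases (auto simp: min_def split: if_splits)
      qed
      ultimately show ?case using d by (auto simp: dist_real_def)
    qed
  qed
qed

text \<open>The midpoint of two distinct maximisers would beat both.\<close>

lemma is_arg_max_unique: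
  fixes F :: "real \<Rightarrow> real"
  assumes quasiconcave: "\<And>x y z. x \<in> A \<Longrightarrow> y \<in> A \<Longrightarrow> x < z \<Longrightarrow> z < y \<Longrightarrow> min (F x) (F y) < F z"
    and "convex A"
    and max: "is_arg_max F (\<lambda>x. x \<in> A) x" "is_arg_max F (\<lambda>x. x \<in> A) y"
  shows "x = y"
proof -
  have False if max: "is_arg_max F (\<lambda>x. x \<in> A) x" "is_arg_max F (\<lambda>x. x \<in> A) y" and "x < y" for x y
  proof -
    have A: "x \<in> A" "y \<in> A" using max by (auto simp: is_arg_max_def)
    have "(x + y) / 2 \<in> A"
      using convexD[OF \<open>convex A\<close> A, of "1/2" "1/2"] by (simp add: add_divide_distrib)
    then have "F ((x + y) / 2) \<le> F x" "F ((x + y) / 2) \<le> F y"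
      using max by (auto simp: is_arg_max_def not_less)
    then show False using quasiconcave[OF A, of "(x + y) / 2"] \<open>x < y\<close> by auto
  qed
  then show ?thesis using max by (metis linorder_neqE_linordered_idom)
qed

section \<open>The two-state market\<close>

text \<open>An open convex \<open>W\<close> containing \<open>w0\<close> covers both domains of the
  utility function, the line and the positive half-line. The bound \<open>1 < c\<close> gives the
  interval of plausible weights positive length; the upper bounds keep it inside (0, 1).\<close>

locale two_state_market =
  fixes p0 S :: "'s::finite \<Rightarrow> real" and u :: "real \<Rightarrow> real" and W :: "real set"
    and w0 c :: real and lo hi :: 's
  assumes states: "UNIV = {lo, hi}"
    and S_less: "S lo < S hi"
    and p0_pos: "0 < p0 lo" "0 < p0 hi"
    and p0_sum: "p0 lo + p0 hi = 1"
    and c_lower: "1 < c"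
    and c_upper: "c < 1 / (1 - p0 lo)" "c < 1 / (1 - p0 hi)"
    and W_open: "open W"
    and W_convex: "convex W"
    and w0_W: "w0 \<in> W"
    and u_concave: "strictly_concave_on W u"
    and u_diff: "u differentiable_on W"
    and u_increasing_at_w0: "0 < deriv u w0"
begin

text \<open>In two states the divergence constraint on \<open>P\<close> reads
  \<open>(P hi - p0 hi)\<^sup>2 \<le> p0 lo * p0 hi * (c - 1)\<close>.\<close>

definition radius :: real where
  "radius = sqrt (p0 lo * p0 hi * (c - 1))"

text \<open>A probability on two states is determined by the weight \<open>x\<close> of the high
  payoff, so expected utility becomes a function of one real weight.\<close>

definition utility :: "real \<Rightarrow> real \<Rightarrow> real \<Rightarrow> real" where
  "utility x \<pi> \<theta> = (1 - x) * u (w0 + \<theta> * (S lo - \<pi>)) + x * u (w0 + \<theta> * (S hi - \<pi>))"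

definition mean :: "real \<Rightarrow> real" where
  "mean x = (1 - x) * S lo + x * S hi"

lemma lo_neq_hi: "lo \<noteq> hi"
  using S_less by auto

lemma all_states: "(\<forall>s. Q s) \<longleftrightarrow> Q lo \<and> Q hi"
  using states by (metis UNIV_I insertE singletonD)

lemma sum_states: "(\<Sum>s\<in>UNIV. f s) = f lo + (f hi :: real)"
  using lo_neq_hi by (simp add: states)

lemma radius_pos: "0 < radius"
  using p0_pos c_lower by (simp add: radius_def)

text \<open>After squaring, \<open>radius < p0 lo\<close> reduces to \<open>c * p0 hi < 1\<close>,
  which is the upper bound on \<open>c\<close> at \<open>lo\<close>; the other inequality is
  symmetric.\<close>

lemma radius_less: "radius < p0 lo" "radius < p0 hi"
proof -
  have hl: "1 - p0 hi = p0 lo" "1 - p0 lo = p0 hi" using p0_sum by auto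
  have *: "c * p0 hi < 1" "c * p0 lo < 1"
    using c_upper p0_pos by (simp_all add: hl field_simps)
  have "p0 hi * (c - 1) < p0 lo" "p0 lo * (c - 1) < p0 hi"
    using * p0_sum by (simp_all add: algebra_simps)
  then have "p0 lo * (p0 hi * (c - 1)) < p0 lo * p0 lo" "p0 hi * (p0 lo * (c - 1)) < p0 hi * p0 hi"
    using p0_pos by auto
  then have "p0 lo * p0 hi * (c - 1) < (p0 lo)\<^sup>2" "p0 lo * p0 hi * (c - 1) < (p0 hi)\<^sup>2"
    by (simp_all add: power2_eq_square algebra_simps)
  then show "radius < p0 lo" "radius < p0 hi"
    using p0_pos unfolding radius_def by (auto intro: real_less_lsqrt)
qed

lemma mean_less_iff: "mean x < mean y \<longleftrightarrow> x < y"
proof -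
  have "mean y - mean x = (y - x) * (S hi - S lo)" by (simp add: mean_def algebra_simps)
  then show ?thesis using S_less by (smt (verit) zero_less_mult_iff)
qed

lemma mean_bounds:
  assumes "0 < x" "x < 1" shows "S lo < mean x" "mean x < S hi"
  using mean_less_iff[of 0 x] mean_less_iff[of x 1] assms by (auto simp: mean_def)

lemma mean_le_iff: "mean x \<le> mean y \<longleftrightarrow> x \<le> y"
  using mean_less_iff[of y x] by linarith

lemma expectation_S: "expectation p0 S = mean (p0 hi)"
proof -
  have "p0 lo = 1 - p0 hi" using p0_sum by simp
  then show ?thesis by (simp add: expectation_def sum_states mean_def)
qed

section \<open>Closed form of the objective\<close>

lemma utility_shift:
  "utility (x + t) \<pi> \<theta> =
     utility x \<pi> \<theta> + t * (u (w0 + \<theta> * (S hi - \<pi>)) - u (w0 + \<theta> * (S lo - \<pi>)))"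
  by (simp add: utility_def algebra_simps)

text \<open>With weights 1 - x and x the divergence sum equals 1 plus the squared deviation of x
  from \<open>p0 hi\<close>, divided by \<open>p0 lo * p0 hi\<close>. Nonnegativity of both weights
  is automatic by \<open>radius_less\<close>.\<close>

lemma plausible_iff:
  "P \<in> plausible_probs p0 c \<longleftrightarrow> P lo = 1 - P hi \<and> \<bar>P hi - p0 hi\<bar> \<le> radius"
proof -
  have lo_eq: "p0 lo = 1 - p0 hi" using p0_sum by simp
  have div: "(1 - x)\<^sup>2 / p0 lo + x\<^sup>2 / p0 hi = 1 + (x - p0 hi)\<^sup>2 / (p0 lo * p0 hi)" for x
  proof -
    have "(1 - x)\<^sup>2 * p0 hi + x\<^sup>2 * p0 lo = p0 lo * p0 hi + (x - p0 hi)\<^sup>2"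
      unfolding lo_eq by (simp add: power2_eq_square algebra_simps)
    then show ?thesis using p0_pos by (simp add: field_simps)
  qed
  have divergence_le: "(1 - x)\<^sup>2 / p0 lo + x\<^sup>2 / p0 hi \<le> c \<longleftrightarrow> \<bar>x - p0 hi\<bar> \<le> radius" for x
  proof -
    have "(1 - x)\<^sup>2 / p0 lo + x\<^sup>2 / p0 hi \<le> c \<longleftrightarrow> (x - p0 hi)\<^sup>2 / (p0 lo * p0 hi) \<le> c - 1"
      unfolding div by auto
    also have "\<dots> \<longleftrightarrow> (x - p0 hi)\<^sup>2 \<le> p0 lo * p0 hi * (c - 1)"
      using p0_pos by (simp add: pos_divide_le_eq mult.commute)
    also have "\<dots> \<longleftrightarrow> \<bar>x - p0 hi\<bar> \<le> radius"
      unfolding radius_def by (metis real_sqrt_abs real_sqrt_le_iff)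
    finally show ?thesis .
  qed
  show ?thesis
  proof
    assume "P \<in> plausible_probs p0 c"
    then have "P lo + P hi = 1" "(P lo)\<^sup>2 / p0 lo + (P hi)\<^sup>2 / p0 hi \<le> c"
      by (auto simp: plausible_probs_def sum_states)
    then show "P lo = 1 - P hi \<and> \<bar>P hi - p0 hi\<bar> \<le> radius"
      using divergence_le[of "P hi"] by (simp add: eq_diff_eq[symmetric])
  next
    assume *: "P lo = 1 - P hi \<and> \<bar>P hi - p0 hi\<bar> \<le> radius"
    then have "0 \<le> P hi" "0 \<le> P lo" using radius_less lo_eq by auto
    then show "P \<in> plausible_probs p0 c"
      using * divergence_le[of "P hi"] by (auto simp: plausible_probs_def sum_states all_states)
  qed
qed

text \<open>Expected utility is affine in the weight, so its extremes over the plausible interval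
  lie at the ends and differ from the centre by \<open>radius\<close> times the absolute utility
  gap. Mixing them with coefficients \<open>a\<close> and \<open>1 - a\<close> leaves the factor
  \<open>1 - 2 * a\<close>.\<close>

lemma objective_eq:
  "objective u w0 p0 c S a \<pi> \<theta> = utility (p0 hi) \<pi> \<theta> +
     (1 - 2 * a) * radius * \<bar>u (w0 + \<theta> * (S hi - \<pi>)) - u (w0 + \<theta> * (S lo - \<pi>))\<bar>"
proof -
  let ?D = "u (w0 + \<theta> * (S hi - \<pi>)) - u (w0 + \<theta> * (S lo - \<pi>))"
  let ?E = "\<lambda>P. expectation P (\<lambda>s. u (w0 + \<theta> * (S s - \<pi>)))"
  have E: "?E P = utility (p0 hi) \<pi> \<theta> + (P hi - p0 hi) * ?D" if "P lo = 1 - P hi" for P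
    unfolding expectation_def sum_states utility_def that by (simp add: algebra_simps)
  have bound: "\<bar>?E P - utility (p0 hi) \<pi> \<theta>\<bar> \<le> radius * \<bar>?D\<bar>" if "P \<in> plausible_probs p0 c" for P
    using that by (auto simp: plausible_iff E abs_mult intro: mult_right_mono)
  have attained: "utility (p0 hi) \<pi> \<theta> + r * \<bar>?D\<bar> \<in> ?E ` plausible_probs p0 c"
    if "\<bar>r\<bar> = radius" for r
  proof -
    \<comment> \<open>The sign of the utility gap selects the end of the interval;
      \<open>r = radius\<close> serves the supremum and \<open>r = - radius\<close> the infimum. If
      the gap is 0, the weight stays at \<open>p0 hi\<close>.\<close>
    define P where "P = (\<lambda>s. if s = hi then p0 hi + sgn ?D * r else 1 - (p0 hi + sgn ?D * r))"
    have P: "P hi = p0 hi + sgn ?D * r" "P lo = 1 - P hi" using lo_neq_hi by (auto simp: P_def)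
    have "P \<in> plausible_probs p0 c"
      using that radius_pos by (auto simp: plausible_iff P abs_mult sgn_if)
    moreover have "?E P = utility (p0 hi) \<pi> \<theta> + r * \<bar>?D\<bar>"
      unfolding E[OF P(2)] P(1) by (simp add: abs_sgn mult_ac)
    ultimately show ?thesis by (metis imageI)
  qed
  have "(INF P\<in>plausible_probs p0 c. ?E P) = utility (p0 hi) \<pi> \<theta> - radius * \<bar>?D\<bar>"
    using attained[of "-radius"] bound radius_pos
    by (intro cInf_eq_minimum) (auto simp: abs_le_iff algebra_simps)
  moreover have "(SUP P\<in>plausible_probs p0 c. ?E P) = utility (p0 hi) \<pi> \<theta> + radius * \<bar>?D\<bar>"
    using attained[of radius] bound radius_pos
    by (intro cSup_eq_maximum) (auto simp: abs_le_iff algebra_simps)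
  ultimately show ?thesis
    unfolding objective_def by (simp only:) (simp add: left_diff_distrib distrib_left right_diff_distrib)
qed

text \<open>The absolute value enters with a nonpositive coefficient here, and -|x| is the minimum
  of x and -x.\<close>

lemma objective_eq_min:
  assumes "1/2 \<le> a"
  shows "objective u w0 p0 c S a \<pi> \<theta> =
     min (utility (p0 hi + (2 * a - 1) * radius) \<pi> \<theta>) (utility (p0 hi - (2 * a - 1) * radius) \<pi> \<theta>)"
proof -
  let ?D = "u (w0 + \<theta> * (S hi - \<pi>)) - u (w0 + \<theta> * (S lo - \<pi>))"
  define b where "b = (2 * a - 1) * radius"
  have "0 \<le> b" using assms radius_pos by (simp add: b_def)
  then have "b * \<bar>?D\<bar> = \<bar>b * ?D\<bar>" by (simp add: abs_mult)
  then have "- (b * \<bar>?D\<bar>) = min (b * ?D) (- b * ?D)" by (auto simp: min_def)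
  moreover have "(1 - 2 * a) * radius = - b" by (simp add: b_def algebra_simps)
  ultimately show ?thesis
    unfolding objective_eq b_def[symmetric]
    using utility_shift[of "p0 hi" b \<pi> \<theta>] utility_shift[of "p0 hi" "- b" \<pi> \<theta>] by auto
qed

text \<open>The sign is now reversed. A maximum of quasiconcave functions need not be quasiconcave,
  which is why demand for \<open>a < 1/2\<close> is later reduced to a single weight.\<close>

lemma objective_eq_max:
  assumes "a \<le> 1/2"
  shows "objective u w0 p0 c S a \<pi> \<theta> =
     max (utility (p0 hi + (1 - 2 * a) * radius) \<pi> \<theta>) (utility (p0 hi - (1 - 2 * a) * radius) \<pi> \<theta>)"
proof -
  let ?D = "u (w0 + \<theta> * (S hi - \<pi>)) - u (w0 + \<theta> * (S lo - \<pi>))"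
  define b where "b = (1 - 2 * a) * radius"
  have "0 \<le> b" using assms radius_pos by (simp add: b_def)
  then have "b * \<bar>?D\<bar> = \<bar>b * ?D\<bar>" by (simp add: abs_mult)
  then have "b * \<bar>?D\<bar> = max (b * ?D) (- b * ?D)" by (auto simp: max_def)
  then show ?thesis
    unfolding objective_eq b_def[symmetric]
    using utility_shift[of "p0 hi" b \<pi> \<theta>] utility_shift[of "p0 hi" "- b" \<pi> \<theta>] by auto
qed

lemma shifted_weight:
  assumes "\<bar>t\<bar> \<le> radius" shows "0 < p0 hi + t" "p0 hi + t < 1"
  using assms radius_less p0_sum by auto

lemma scaled_radius_le:
  assumes "\<bar>r\<bar> \<le> 1" shows "\<bar>r * radius\<bar> \<le> radius"
  using assms radius_pos mult_right_mono[of "\<bar>r\<bar>" 1 radius] by (simp add: abs_mult)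

section \<open>Admissible positions and continuity\<close>

lemma admissible_iff:
  "\<theta> \<in> admissible W w0 S \<pi> \<longleftrightarrow> w0 + \<theta> * (S lo - \<pi>) \<in> W \<and> w0 + \<theta> * (S hi - \<pi>) \<in> W"
  by (simp add: admissible_def all_states)

lemma zero_admissible: "0 \<in> admissible W w0 S \<pi>"
  using w0_W by (simp add: admissible_iff)

text \<open>Price and position vary together, so that one statement yields openness of the
  admissible set, persistence of a position under price changes and admissibility of small
  positions.\<close>

lemma eventually_admissible:
  assumes "\<theta> \<in> admissible W w0 S \<pi>" "(f \<longlongrightarrow> \<pi>) F" "(g \<longlongrightarrow> \<theta>) F"
  shows "\<forall>\<^sub>F z in F. g z \<in> admissible W w0 S (f z)"
proof -
  have "((\<lambda>z. w0 + g z * (S s - f z)) \<longlongrightarrow> w0 + \<theta> * (S s - \<pi>)) F" for s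
    by (intro tendsto_intros assms)
  then have "\<forall>\<^sub>F z in F. w0 + g z * (S s - f z) \<in> W" if "w0 + \<theta> * (S s - \<pi>) \<in> W" for s
    using that W_open by (metis topological_tendstoD)
  then show ?thesis
    using assms(1) unfolding admissible_iff by (simp add: eventually_conj)
qed

lemma open_admissible: "open (admissible W w0 S \<pi>)"
proof (rule topological_space_class.openI)
  fix \<theta> assume "\<theta> \<in> admissible W w0 S \<pi>"
  then have "\<forall>\<^sub>F z in nhds \<theta>. z \<in> admissible W w0 S \<pi>"
    by (rule eventually_admissible) (auto intro: tendsto_ident_at filterlim_ident)
  then show "\<exists>T. open T \<and> \<theta> \<in> T \<and> T \<subseteq> admissible W w0 S \<pi>"
    unfolding eventually_nhds by blast
qed

lemma convex_admissible: "convex (admissible W w0 S \<pi>)"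
proof (rule convexI)
  fix x y s t :: real
  assume "x \<in> admissible W w0 S \<pi>" "y \<in> admissible W w0 S \<pi>" and st: "0 \<le> s" "0 \<le> t" "s + t = 1"
  moreover have "w0 + (s *\<^sub>R x + t *\<^sub>R y) * r = s *\<^sub>R (w0 + x * r) + t *\<^sub>R (w0 + y * r)" for r
  proof -
    have "w0 = s * w0 + t * w0" using st by (metis distrib_right mult_1)
    then show ?thesis by (simp add: algebra_simps)
  qed
  ultimately show "s *\<^sub>R x + t *\<^sub>R y \<in> admissible W w0 S \<pi>"
    unfolding admissible_iff by (metis convexD[OF W_convex])
qed

lemma tendsto_utility:
  assumes "\<theta> \<in> admissible W w0 S \<pi>" "(f \<longlongrightarrow> \<pi>) F" "(g \<longlongrightarrow> \<theta>) F"
  shows "((\<lambda>z. utility x (f z) (g z)) \<longlongrightarrow> utility x \<pi> \<theta>) F"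
proof -
  have "isCont u y" if "y \<in> W" for y
    using u_diff that W_open differentiable_imp_continuous_on continuous_on_eq_continuous_at by blast
  then have "((\<lambda>z. u (w0 + g z * (S s - f z))) \<longlongrightarrow> u (w0 + \<theta> * (S s - \<pi>))) F"
    if "w0 + \<theta> * (S s - \<pi>) \<in> W" for s
    using that by (intro isCont_tendsto_compose[of _ u] tendsto_intros assms) auto
  then show ?thesis
    using assms(1) unfolding utility_def admissible_iff by (intro tendsto_intros) auto
qed

section \<open>Comparison with the zero position\<close>

lemma DERIV_u: "(u has_real_derivative deriv u w0) (at w0)"
  using u_diff W_open w0_W
  by (metis DERIV_deriv_iff_real_differentiable at_within_open differentiable_on_def)

text \<open>If \<open>u y\<close> were at least \<open>u w0\<close>, concavity would lift
  \<open>u\<close> above \<open>u w0\<close> at points just left of \<open>w0\<close>, against the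
  positive derivative there.\<close>

lemma u_less_left:
  assumes "y \<in> W" "y < w0" shows "u y < u w0"
proof (rule ccontr)
  assume "\<not> u y < u w0"
  obtain d where d: "0 < d" "\<And>h. 0 < h \<Longrightarrow> h < d \<Longrightarrow> u (w0 - h) < u w0"
    using DERIV_pos_inc_left[OF DERIV_u u_increasing_at_w0] by blast
  define h where "h = min d (w0 - y) / 2"
  have h: "0 < h" "h < d" "h < w0 - y" using d assms by (auto simp: h_def min_def)
  define t where "t = h / (w0 - y)"
  have t: "0 < t" "t < 1" using h by (auto simp: t_def)
  have "t * (w0 - y) = h" using assms by (simp add: t_def)
  then have "(1 - t) * w0 + t * y = w0 - h" by (simp add: algebra_simps)
  then have "(1 - t) * u w0 + t * u y < u (w0 - h)"
    using u_concave t assms w0_W unfolding strictly_concave_on_def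
    by (metis less_irrefl)
  moreover have "t * u w0 \<le> t * u y" using t \<open>\<not> u y < u w0\<close> by (simp add: mult_left_mono)
  ultimately show False using d(2)[OF h(1,2)] by (simp add: algebra_simps)
qed

lemma utility_zero [simp]: "utility x \<pi> 0 = u w0"
  by (simp add: utility_def algebra_simps)

text \<open>By strict concavity the expected utility lies below the utility of mean wealth. Since
  the expected gain is not positive, mean wealth is at most \<open>w0\<close>, and
  \<open>u_less_left\<close> applies.\<close>

lemma utility_less:
  assumes x: "0 < x" "x < 1" and "\<theta> \<noteq> 0" "\<theta> * (mean x - \<pi>) \<le> 0"
    and adm: "\<theta> \<in> admissible W w0 S \<pi>"
  shows "utility x \<pi> \<theta> < u w0"
proof -
  let ?l = "w0 + \<theta> * (S lo - \<pi>)" and ?h = "w0 + \<theta> * (S hi - \<pi>)" and ?m = "w0 + \<theta> * (mean x - \<pi>)"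
  have W: "?l \<in> W" "?h \<in> W" using adm by (auto simp: admissible_iff)
  have m: "?m = (1 - x) * ?l + x * ?h" by (simp add: mean_def algebra_simps)
  have "?l \<noteq> ?h" using S_less \<open>\<theta> \<noteq> 0\<close> by auto
  then have "utility x \<pi> \<theta> < u ?m"
    using u_concave W x unfolding strictly_concave_on_def utility_def m by blast
  also have "\<dots> \<le> u w0"
  proof -
    have "?m \<in> W" using convexD[OF W_convex W, of "1 - x" x] x unfolding m by simp
    then show ?thesis using u_less_left[of ?m] assms(4) by (cases "?m = w0") auto
  qed
  finally show ?thesis .
qed

text \<open>The sign of the mean payoff minus the price decides whether a small long or a small
  short position improves on holding nothing.\<close>

lemma DERIV_utility: "(utility x \<pi> has_real_derivative deriv u w0 * (mean x - \<pi>)) (at 0)"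
proof -
  have "((\<lambda>\<theta>. u (w0 + \<theta> * r)) has_real_derivative deriv u w0 * r) (at 0)" for r
    by (rule DERIV_chain2[where g = "\<lambda>\<theta>. w0 + \<theta> * r"])
       (auto intro!: derivative_eq_intros DERIV_u)
  then have "((\<lambda>\<theta>. (1 - x) * u (w0 + \<theta> * (S lo - \<pi>)) + x * u (w0 + \<theta> * (S hi - \<pi>)))
      has_real_derivative (1 - x) * (deriv u w0 * (S lo - \<pi>)) + x * (deriv u w0 * (S hi - \<pi>))) (at 0)"
    by (intro DERIV_add DERIV_cmult)
  moreover have "(1 - x) * (deriv u w0 * (S lo - \<pi>)) + x * (deriv u w0 * (S hi - \<pi>)) =
      deriv u w0 * (mean x - \<pi>)"
    by (simp add: mean_def algebra_simps)
  ultimately show ?thesis unfolding utility_def[abs_def] by simp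
qed

lemma eventually_utility_greater_right:
  assumes "\<pi> < mean x" shows "\<forall>\<^sub>F \<theta> in at_right 0. u w0 < utility x \<pi> \<theta>"
proof -
  have "0 < deriv u w0 * (mean x - \<pi>)" using assms u_increasing_at_w0 by simp
  from DERIV_pos_inc_right[OF DERIV_utility this]
  show ?thesis unfolding eventually_at_right_field by auto
qed

lemma eventually_utility_greater_left:
  assumes "mean x < \<pi>" shows "\<forall>\<^sub>F \<theta> in at_left 0. u w0 < utility x \<pi> \<theta>"
proof -
  have "deriv u w0 * (mean x - \<pi>) < 0" using assms u_increasing_at_w0 by (simp add: mult_pos_neg)
  from DERIV_neg_dec_left[OF DERIV_utility this]
  obtain d where d: "0 < d" "\<And>h. 0 < h \<Longrightarrow> h < d \<Longrightarrow> u w0 < utility x \<pi> (- h)" by auto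
  have "u w0 < utility x \<pi> \<theta>" if "- d < \<theta>" "\<theta> < 0" for \<theta> using d(2)[of "- \<theta>"] that by simp
  then show ?thesis unfolding eventually_at_left_field using d(1) by (intro exI[of _ "- d"]) auto
qed

lemma eventually_admissible_zero:
  "\<forall>\<^sub>F \<theta> in at 0 within T. \<theta> \<in> admissible W w0 S \<pi>"
  by (rule eventually_admissible[OF zero_admissible]) (auto intro: tendsto_ident_at)

section \<open>Strict quasiconcavity in the position\<close>

text \<open>At a price strictly between the payoffs both excess payoffs are nonzero, so wealth in
  each state moves with the position and strict concavity of \<open>u\<close> carries over.\<close>

lemma utility_quasiconcave:
  assumes x: "0 < x" "x < 1" and \<pi>: "S lo < \<pi>" "\<pi> < S hi"
    and adm: "a \<in> admissible W w0 S \<pi>" "b \<in> admissible W w0 S \<pi>" and z: "a < z" "z < b"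
  shows "min (utility x \<pi> a) (utility x \<pi> b) < utility x \<pi> z"
proof -
  define t where "t = (z - a) / (b - a)"
  have t: "0 < t" "t < 1" using z by (auto simp: t_def)
  have "t * (b - a) = z - a" using z by (simp add: t_def)
  then have z_eq: "z = (1 - t) * a + t * b" by (simp add: algebra_simps)
  have step: "(1 - t) * u (w0 + a * r) + t * u (w0 + b * r) < u (w0 + z * r)"
    if "w0 + a * r \<in> W" "w0 + b * r \<in> W" "r \<noteq> 0" for r
  proof -
    have "w0 + z * r = (1 - t) * (w0 + a * r) + t * (w0 + b * r)"
      unfolding z_eq by (simp add: algebra_simps)
    moreover have "w0 + a * r \<noteq> w0 + b * r" using z \<open>r \<noteq> 0\<close> by simp
    ultimately show ?thesis using u_concave t that unfolding strictly_concave_on_def by auto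
  qed
  have "(1 - t) * utility x \<pi> a + t * utility x \<pi> b =
      (1 - x) * ((1 - t) * u (w0 + a * (S lo - \<pi>)) + t * u (w0 + b * (S lo - \<pi>))) +
      x * ((1 - t) * u (w0 + a * (S hi - \<pi>)) + t * u (w0 + b * (S hi - \<pi>)))"
    by (simp add: utility_def algebra_simps)
  also have "\<dots> < utility x \<pi> z"
    unfolding utility_def using adm \<pi> x unfolding admissible_iff
    by (intro add_strict_mono mult_strict_left_mono step) auto
  finally have *: "(1 - t) * utility x \<pi> a + t * utility x \<pi> b < utility x \<pi> z" .
  let ?m = "min (utility x \<pi> a) (utility x \<pi> b)"
  have "?m = (1 - t) * ?m + t * ?m" by (simp add: algebra_simps)
  also have "\<dots> \<le> (1 - t) * utility x \<pi> a + t * utility x \<pi> b"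
    using t by (intro add_mono mult_left_mono) auto
  finally show ?thesis using * by linarith
qed

text \<open>Strict quasiconcavity passes to the minimum of two functions.\<close>

lemma averse_objective_quasiconcave:
  assumes a: "1/2 \<le> a" "a \<le> 1" and \<pi>: "S lo < \<pi>" "\<pi> < S hi"
    and adm: "x \<in> admissible W w0 S \<pi>" "y \<in> admissible W w0 S \<pi>" and z: "x < z" "z < y"
  shows "min (objective u w0 p0 c S a \<pi> x) (objective u w0 p0 c S a \<pi> y) < objective u w0 p0 c S a \<pi> z"
proof -
  let ?r = "(2 * a - 1) * radius"
  have "\<bar>?r\<bar> \<le> radius" "\<bar>- ?r\<bar> \<le> radius" using a scaled_radius_le[of "2 * a - 1"] by auto
  note w = shifted_weight[OF this(1)] shifted_weight[OF this(2)]
  show ?thesis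
    using utility_quasiconcave[OF w(1,2) \<pi> adm z] utility_quasiconcave[OF w(3,4) \<pi> adm z]
    unfolding objective_eq_min[OF a(1)] by auto
qed

section \<open>Demand for \<alpha> \<ge> 1/2\<close>

lemma averse_demand_eq:
  assumes "1/2 \<le> a"
  shows "second_best_demand W u w0 p0 c S a \<pi> =
    {\<theta>. is_arg_max (objective u w0 p0 c S a \<pi>) (\<lambda>\<theta>. \<theta> \<in> admissible W w0 S \<pi>) \<theta>}"
  using assms by (simp add: second_best_demand_def second_best_admissible_def)

lemma averse_demand_singleton:
  assumes a: "1/2 \<le> a" "a \<le> 1" and \<pi>: "S lo < \<pi>" "\<pi> < S hi"
    and "\<theta> \<in> second_best_demand W u w0 p0 c S a \<pi>"
  shows "second_best_demand W u w0 p0 c S a \<pi> = {\<theta>}"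
proof -
  have "x = y" if "x \<in> second_best_demand W u w0 p0 c S a \<pi>" "y \<in> second_best_demand W u w0 p0 c S a \<pi>"
    for x y
    using that averse_objective_quasiconcave[OF a \<pi>] convex_admissible
    unfolding averse_demand_eq[OF a(1)]
    by (intro is_arg_max_unique[where F = "objective u w0 p0 c S a \<pi>" and A = "admissible W w0 S \<pi>"])
       auto
  then show ?thesis using assms(5) by blast
qed

text \<open>The lower of the two weights has a mean payoff at most the price, so a long position
  loses under it, and the objective is no larger than that utility.\<close>

lemma averse_demand_nonpos:
  assumes a: "1/2 \<le> a" "a \<le> 1" and \<pi>: "mean (p0 hi) \<le> \<pi>"
    and \<theta>: "\<theta> \<in> second_best_demand W u w0 p0 c S a \<pi>"
  shows "\<theta> \<le> 0"
proof (rule ccontr)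
  assume "\<not> \<theta> \<le> 0"
  let ?r = "(2 * a - 1) * radius"
  have "\<bar>- ?r\<bar> \<le> radius" using a scaled_radius_le[of "2 * a - 1"] by auto
  note w = shifted_weight[OF this]
  have "mean (p0 hi + - ?r) \<le> \<pi>"
    using \<pi> a radius_pos mean_le_iff[of "p0 hi + - ?r" "p0 hi"] by auto
  then have "\<theta> * (mean (p0 hi + - ?r) - \<pi>) \<le> 0"
    using \<open>\<not> \<theta> \<le> 0\<close> by (intro mult_nonneg_nonpos) auto
  moreover have adm: "\<theta> \<in> admissible W w0 S \<pi>"
    using \<theta> unfolding averse_demand_eq[OF a(1)] is_arg_max_def by auto
  ultimately have "utility (p0 hi + - ?r) \<pi> \<theta> < u w0"
    using utility_less[OF w] \<open>\<not> \<theta> \<le> 0\<close> by auto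
  then have "objective u w0 p0 c S a \<pi> \<theta> < objective u w0 p0 c S a \<pi> 0"
    unfolding objective_eq_min[OF a(1)] by auto
  then show False
    using \<theta> zero_admissible unfolding averse_demand_eq[OF a(1)] is_arg_max_def by blast
qed

text \<open>Long positions are excluded by \<open>averse_demand_nonpos\<close>; short ones lose
  under the upper weight, whose mean payoff is at least the price.\<close>

lemma averse_demand_zero:
  assumes a: "1/2 \<le> a" "a \<le> 1"
    and \<pi>: "mean (p0 hi) \<le> \<pi>" "\<pi> \<le> mean (p0 hi + (2 * a - 1) * radius)"
    and \<theta>: "\<theta> \<in> second_best_demand W u w0 p0 c S a \<pi>"
  shows "\<theta> = 0"
proof (rule ccontr)
  assume "\<theta> \<noteq> 0"
  then have "\<theta> < 0" using averse_demand_nonpos[OF a \<pi>(1) \<theta>] by simp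
  let ?r = "(2 * a - 1) * radius"
  have "\<bar>?r\<bar> \<le> radius" using a scaled_radius_le[of "2 * a - 1"] by auto
  note w = shifted_weight[OF this]
  have "\<theta> * (mean (p0 hi + ?r) - \<pi>) \<le> 0"
    using \<open>\<theta> < 0\<close> \<pi>(2) by (intro mult_nonpos_nonneg) auto
  moreover have "\<theta> \<in> admissible W w0 S \<pi>"
    using \<theta> unfolding averse_demand_eq[OF a(1)] is_arg_max_def by auto
  ultimately have "utility (p0 hi + ?r) \<pi> \<theta> < u w0"
    using utility_less[OF w] \<open>\<theta> \<noteq> 0\<close> by auto
  then have "objective u w0 p0 c S a \<pi> \<theta> < objective u w0 p0 c S a \<pi> 0"
    unfolding objective_eq_min[OF a(1)] by auto
  then show False
    using \<theta> zero_admissible unfolding averse_demand_eq[OF a(1)] is_arg_max_def by blast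
qed

text \<open>Both weights have mean payoffs below the price, so a small short position raises both
  utilities and hence their minimum.\<close>

lemma averse_demand_neg:
  assumes a: "1/2 \<le> a" "a \<le> 1"
    and \<pi>: "mean (p0 hi + (2 * a - 1) * radius) < \<pi>"
    and \<theta>: "\<theta> \<in> second_best_demand W u w0 p0 c S a \<pi>"
  shows "\<theta> < 0"
proof -
  let ?r = "(2 * a - 1) * radius"
  have r: "0 \<le> ?r" using a radius_pos by auto
  have lt: "mean (p0 hi - ?r) < \<pi>" "mean (p0 hi) \<le> \<pi>"
    using r \<pi> mean_le_iff[of "p0 hi - ?r" "p0 hi + ?r"] mean_le_iff[of "p0 hi" "p0 hi + ?r"] by auto
  have "\<forall>\<^sub>F t in at_left 0. t \<in> admissible W w0 S \<pi> \<and>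
      u w0 < utility (p0 hi + ?r) \<pi> t \<and> u w0 < utility (p0 hi - ?r) \<pi> t"
    by (intro eventually_conj eventually_admissible_zero eventually_utility_greater_left \<pi> lt)
  then obtain t where "t \<in> admissible W w0 S \<pi>"
      "u w0 < utility (p0 hi + ?r) \<pi> t" "u w0 < utility (p0 hi - ?r) \<pi> t"
    using eventually_happens'[OF trivial_limit_at_left_real] by blast
  then have "t \<in> admissible W w0 S \<pi>" "objective u w0 p0 c S a \<pi> 0 < objective u w0 p0 c S a \<pi> t"
    unfolding objective_eq_min[OF a(1)] by auto
  then have "\<theta> \<noteq> 0" using \<theta> unfolding averse_demand_eq[OF a(1)] is_arg_max_def by blast
  then show ?thesis using averse_demand_nonpos[OF a lt(2) \<theta>] by simp
qed

section \<open>Demand for \<alpha> < 1/2 above the reference mean\<close>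

text \<open>Above the reference mean, long positions held under the pessimistic weight are worse than
  holding nothing, so only the optimistic weight matters; up to the optimistic mean, the sign
  constraint on the position does not bind.\<close>

lemma seeking_demand_eq:
  assumes a: "0 \<le> a" "a < 1/2"
    and \<pi>: "mean (p0 hi) < \<pi>" "\<pi> \<le> mean (p0 hi + (1 - 2 * a) * radius)"
  shows "second_best_demand W u w0 p0 c S a \<pi> =
    {\<theta>. is_arg_max (utility (p0 hi + (1 - 2 * a) * radius) \<pi>) (\<lambda>\<theta>. \<theta> \<in> admissible W w0 S \<pi>) \<theta>}"
proof -
  let ?A = "admissible W w0 S \<pi>" and ?V = "objective u w0 p0 c S a \<pi>"
  let ?r = "(1 - 2 * a) * radius"
  let ?U = "utility (p0 hi + ?r) \<pi>"
  have r: "\<bar>?r\<bar> \<le> radius" "\<bar>- ?r\<bar> \<le> radius" using a scaled_radius_le[of "1 - 2 * a"] by auto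
  note w = shifted_weight[OF r(1)] shifted_weight[OF r(2)]
  have "0 \<le> ?r" using a radius_pos by auto
  then have mean_low: "mean (p0 hi + - ?r) \<le> \<pi>"
    using \<pi> mean_le_iff[of "p0 hi + - ?r" "p0 hi"] by auto
  have V0: "?V 0 = u w0" using a by (simp add: objective_eq_max)
  have U_le: "?U \<theta> \<le> ?V \<theta>" for \<theta> using a by (simp add: objective_eq_max)
  have V_eq: "?V \<theta> = ?U \<theta>" if "\<theta> \<in> ?A" "0 \<le> \<theta>" "u w0 \<le> ?V \<theta>" for \<theta>
  proof (cases "\<theta> = 0")
    case True
    then show ?thesis using V0 by simp
  next
    case False
    have "\<theta> * (mean (p0 hi + - ?r) - \<pi>) \<le> 0" using mean_low that by (intro mult_nonneg_nonpos) auto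
    then have "utility (p0 hi - ?r) \<pi> \<theta> < u w0"
      using utility_less[OF w(3,4) False _ that(1)] by simp
    then show ?thesis using that a by (auto simp: objective_eq_max max_def split: if_splits)
  qed
  have U_neg: "?U \<theta> < u w0" if "\<theta> \<in> ?A" "\<theta> < 0" for \<theta>
    using that \<pi> by (intro utility_less[OF w(1,2)] mult_nonpos_nonneg) auto
  have adm: "second_best_admissible W w0 p0 S a \<pi> = ?A \<inter> {0..}"
    using a \<pi> by (simp add: second_best_admissible_def expectation_S)
  \<comment> \<open>\<open>?V\<close> dominates \<open>?U\<close> everywhere and agrees with it at
    long positions no worse than 0, while \<open>?U\<close> is below \<open>u w0\<close> at short
    positions. Hence the maximisers coincide.\<close>
  have "is_arg_max ?V (\<lambda>\<theta>. \<theta> \<in> ?A \<inter> {0..}) \<theta> \<longleftrightarrow> is_arg_max ?U (\<lambda>\<theta>. \<theta> \<in> ?A) \<theta>" for \<theta>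
  proof
    assume *: "is_arg_max ?V (\<lambda>\<theta>. \<theta> \<in> ?A \<inter> {0..}) \<theta>"
    then have \<theta>: "\<theta> \<in> ?A" "0 \<le> \<theta>" "\<And>y. y \<in> ?A \<Longrightarrow> 0 \<le> y \<Longrightarrow> ?V y \<le> ?V \<theta>"
      by (auto simp: is_arg_max_def not_less)
    have ge: "u w0 \<le> ?V \<theta>" using \<theta>(3)[OF zero_admissible] V0 by simp
    have "?U y \<le> ?U \<theta>" if "y \<in> ?A" for y
    proof (cases "0 \<le> y")
      case True
      then show ?thesis using \<theta>(3)[OF that] U_le[of y] V_eq[OF \<theta>(1,2) ge] by simp
    next
      case False
      then show ?thesis using U_neg[OF that] V_eq[OF \<theta>(1,2) ge] ge by simp
    qed
    then show "is_arg_max ?U (\<lambda>\<theta>. \<theta> \<in> ?A) \<theta>" using \<theta>(1) by (auto simp: is_arg_max_def not_less)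
  next
    assume *: "is_arg_max ?U (\<lambda>\<theta>. \<theta> \<in> ?A) \<theta>"
    then have \<theta>: "\<theta> \<in> ?A" "\<And>y. y \<in> ?A \<Longrightarrow> ?U y \<le> ?U \<theta>"
      by (auto simp: is_arg_max_def not_less)
    have ge: "u w0 \<le> ?U \<theta>" using \<theta>(2)[OF zero_admissible] by simp
    have "0 \<le> \<theta>" using U_neg[OF \<theta>(1)] ge by linarith
    moreover have "?V y \<le> ?V \<theta>" if "y \<in> ?A" "0 \<le> y" for y
      using V_eq[OF that] \<theta>(2)[OF that(1)] U_le[of \<theta>] ge by linarith
    ultimately show "is_arg_max ?V (\<lambda>\<theta>. \<theta> \<in> ?A \<inter> {0..}) \<theta>"
      using \<theta>(1) by (auto simp: is_arg_max_def not_less)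
  qed
  then show ?thesis by (simp add: second_best_demand_def adm)
qed

section \<open>Existence of the equilibrium price\<close>

theorem nonzero_equilibrium_exists:
  fixes \<alpha> :: "nat \<Rightarrow> real"
  assumes I: "finite I" "k \<in> I" "j \<in> I" "j \<noteq> k"
    and seeking: "0 \<le> \<alpha> k" "\<alpha> k < 1/2"
    and averse: "\<And>i. i \<in> I - {k} \<Longrightarrow> 1/2 \<le> \<alpha> i \<and> \<alpha> i \<le> 1"
    and least: "\<And>i. i \<in> I - {k} \<Longrightarrow> \<alpha> j \<le> \<alpha> i"
    and condition: "\<alpha> k + \<alpha> j < 1"
    and demands: "\<And>\<pi> i. S lo < \<pi> \<Longrightarrow> \<pi> < S hi \<Longrightarrow> i \<in> I \<Longrightarrow>
           second_best_demand W u w0 p0 c S (\<alpha> i) \<pi> \<noteq> {}"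
  shows "\<exists>\<pi>. S lo < \<pi> \<and> \<pi> < S hi \<and>
           nonzero_second_best_equilibrium_price W u w0 p0 c S I \<alpha> 0 \<pi>"
proof -
  let ?demand = "\<lambda>i \<pi>. second_best_demand W u w0 p0 c S (\<alpha> i) \<pi>"
  \<comment> \<open>\<open>b\<close> is the optimistic weight that alone governs investor
    \<open>k\<close> above the reference mean.\<close>
  define b where "b = p0 hi + (1 - 2 * \<alpha> k) * radius"
  define \<pi>0 where "\<pi>0 = mean (p0 hi + (2 * \<alpha> j - 1) * radius)"
  define \<pi>1 where "\<pi>1 = mean b"
  have j: "j \<in> I - {k}" using I by simp
  have b: "0 < b" "b < 1"
    unfolding b_def using seeking by (auto intro!: shifted_weight scaled_radius_le)
  \<comment> \<open>Rewritten in this way, \<open>condition\<close> places the upper weight of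
    \<open>j\<close> below \<open>b\<close>.\<close>
  have "2 * \<alpha> j - 1 < 1 - 2 * \<alpha> k" using condition by simp
  then have less: "\<pi>0 < \<pi>1"
    unfolding \<pi>0_def \<pi>1_def b_def mean_less_iff using radius_pos by simp
  have \<pi>0_ge: "mean (p0 hi) \<le> \<pi>0"
    unfolding \<pi>0_def mean_le_iff using averse[OF j] radius_pos by simp
  have \<pi>0_lo: "S lo < \<pi>0" using \<pi>0_ge mean_bounds(1)[of "p0 hi"] p0_pos p0_sum by linarith
  have \<pi>1_hi: "\<pi>1 < S hi" using mean_bounds[OF b] by (simp add: \<pi>1_def)
  define \<theta> where "\<theta> i \<pi> = (SOME \<theta>. \<theta> \<in> ?demand i \<pi>)" for i \<pi>
  have \<theta>_mem: "\<theta> i \<pi> \<in> ?demand i \<pi>" if "\<pi>0 \<le> \<pi>" "\<pi> \<le> \<pi>1" "i \<in> I" for i \<pi>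
    unfolding \<theta>_def using demands[of \<pi> i] that \<pi>0_lo \<pi>1_hi by (auto simp: some_in_eq)
  \<comment> \<open>The price \<open>\<pi>0\<close> is excluded: for \<open>\<alpha> j = 1/2\<close>
    it equals the reference mean, where investor \<open>k\<close> is confined to nonpositive
    positions.\<close>
  have seeking_argmax: "?demand k \<pi> =
      {\<theta>. is_arg_max (utility b \<pi>) (\<lambda>\<theta>. \<theta> \<in> admissible W w0 S \<pi>) \<theta>}" if "\<pi>0 < \<pi>" "\<pi> \<le> \<pi>1" for \<pi>
  proof -
    have "mean (p0 hi) < \<pi>" using that \<pi>0_ge by linarith
    then show ?thesis
      using that(2) unfolding \<pi>1_def b_def by (rule seeking_demand_eq[OF seeking])
  qed
  have singleton: "?demand i \<pi> = {\<theta> i \<pi>}" if \<pi>: "\<pi>0 < \<pi>" "\<pi> \<le> \<pi>1" and "i \<in> I" for i \<pi>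
  proof (cases "i = k")
    case True
    have "S lo < \<pi>" "\<pi> < S hi" using \<pi> \<pi>0_lo \<pi>1_hi by auto
    note quasiconcave = utility_quasiconcave[OF b this]
    have "x = y" if "x \<in> ?demand k \<pi>" "y \<in> ?demand k \<pi>" for x y
      using that quasiconcave convex_admissible unfolding seeking_argmax[OF \<pi>]
      by (intro is_arg_max_unique[where F = "utility b \<pi>" and A = "admissible W w0 S \<pi>"]) auto
    then show ?thesis using \<theta>_mem[of \<pi> k] \<pi> I(2) True by force
  next
    case False
    then show ?thesis
      using averse[of i] \<theta>_mem[of \<pi> i] \<pi> \<open>i \<in> I\<close> \<pi>0_lo \<pi>1_hi by (intro averse_demand_singleton) auto
  qed
  have cont_averse: "continuous_on {\<pi>0..\<pi>1} (\<theta> i)" if "i \<in> I - {k}" for i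
  proof (rule continuous_on_argmax)
    have a: "1/2 \<le> \<alpha> i" "\<alpha> i \<le> 1" using averse[OF that] by auto
    fix \<pi> assume \<pi>: "\<pi> \<in> {\<pi>0..\<pi>1}"
    show "is_arg_max (objective u w0 p0 c S (\<alpha> i) \<pi>) (\<lambda>x. x \<in> admissible W w0 S \<pi>) (\<theta> i \<pi>)"
      using \<theta>_mem[of \<pi> i] \<pi> that unfolding averse_demand_eq[OF a(1)] by auto
    show "open (admissible W w0 S \<pi>)" by (rule open_admissible)
    fix x assume x: "x \<in> admissible W w0 S \<pi>"
    show "\<forall>\<^sub>F \<pi>' in at \<pi> within {\<pi>0..\<pi>1}. x \<in> admissible W w0 S \<pi>'"
      by (rule eventually_admissible[OF x]) auto
    show "((\<lambda>\<pi>'. objective u w0 p0 c S (\<alpha> i) \<pi>' x) \<longlongrightarrow> objective u w0 p0 c S (\<alpha> i) \<pi> x)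
        (at \<pi> within {\<pi>0..\<pi>1})"
      unfolding objective_eq_min[OF a(1)] by (intro tendsto_min tendsto_utility[OF x]) auto
    fix y z assume "y \<in> admissible W w0 S \<pi>" "x < z" "z < y"
    then show "min (objective u w0 p0 c S (\<alpha> i) \<pi> x) (objective u w0 p0 c S (\<alpha> i) \<pi> y)
        < objective u w0 p0 c S (\<alpha> i) \<pi> z"
      using \<pi> \<pi>0_lo \<pi>1_hi x by (intro averse_objective_quasiconcave[OF a]) auto
  qed
  have cont_seeking: "continuous_on {\<pi>0<..\<pi>1} (\<theta> k)"
  proof (rule continuous_on_argmax)
    fix \<pi> assume \<pi>: "\<pi> \<in> {\<pi>0<..\<pi>1}"
    show "is_arg_max (utility b \<pi>) (\<lambda>x. x \<in> admissible W w0 S \<pi>) (\<theta> k \<pi>)"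
      using \<theta>_mem[of \<pi> k] \<pi> I(2) seeking_argmax[of \<pi>] by auto
    show "open (admissible W w0 S \<pi>)" by (rule open_admissible)
    fix x assume x: "x \<in> admissible W w0 S \<pi>"
    show "\<forall>\<^sub>F \<pi>' in at \<pi> within {\<pi>0<..\<pi>1}. x \<in> admissible W w0 S \<pi>'"
      by (rule eventually_admissible[OF x]) auto
    show "((\<lambda>\<pi>'. utility b \<pi>' x) \<longlongrightarrow> utility b \<pi> x) (at \<pi> within {\<pi>0<..\<pi>1})"
      by (intro tendsto_utility[OF x]) auto
    fix y z assume "y \<in> admissible W w0 S \<pi>" "x < z" "z < y"
    then show "min (utility b \<pi> x) (utility b \<pi> y) < utility b \<pi> z"
      using \<pi> \<pi>0_lo \<pi>1_hi x by (intro utility_quasiconcave[OF b]) auto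
  qed
  \<comment> \<open>Below \<open>\<pi>1\<close> a small long position has positive expected gain
    under \<open>b\<close>. This gives the lower bound on demand near \<open>\<pi>0\<close> and, at
    the end, a nonzero equilibrium.\<close>
  have better_right: "\<exists>t>0. t \<in> admissible W w0 S \<pi> \<and> u w0 < utility b \<pi> t" if "\<pi> < \<pi>1" for \<pi>
  proof -
    have "\<forall>\<^sub>F t in at_right 0. 0 < t \<and> t \<in> admissible W w0 S \<pi> \<and> u w0 < utility b \<pi> t"
      using that unfolding \<pi>1_def
      by (intro eventually_conj eventually_admissible_zero eventually_utility_greater_right
            eventually_at_right_less)
    then show ?thesis using eventually_happens'[OF trivial_limit_at_right_real] by blast
  qed

  text \<open>When \<open>\<pi>0\<close> is the reference mean, an optimum under the optimistic weight is not assumed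
    to exist at \<open>\<pi>0\<close>, so instead of right-continuity only a positive lower bound near \<open>\<pi>0\<close> is
    used.\<close>
  have "\<exists>e>0. \<forall>\<^sub>F \<pi> in at_right \<pi>0. e < \<theta> k \<pi>"
  proof -
    obtain t where t: "0 < t" "t \<in> admissible W w0 S \<pi>0" "u w0 < utility b \<pi>0 t"
      using better_right[OF less] by blast
    \<comment> \<open>At \<open>\<pi>0\<close> small positions yield about \<open>u w0\<close>, less
      than \<open>t\<close> does. A fixed such \<open>e\<close> below \<open>t\<close> stays worse
      than \<open>t\<close> at prices just above \<open>\<pi>0\<close>, so by quasiconcavity the
      maximiser lies to the right of \<open>e\<close>.\<close>
    have "((\<lambda>e. utility b \<pi>0 e) \<longlongrightarrow> utility b \<pi>0 0) (at_right 0)"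
      by (rule tendsto_utility[OF zero_admissible]) auto
    then have "\<forall>\<^sub>F e in at_right 0. utility b \<pi>0 e < utility b \<pi>0 t"
      using t by (intro order_tendstoD(2)) auto
    moreover have "\<forall>\<^sub>F e in at_right 0. e < t"
      using t(1) by (auto simp: eventually_at_right_field)
    ultimately have "\<forall>\<^sub>F e in at_right 0. 0 < e \<and> e < t \<and> e \<in> admissible W w0 S \<pi>0 \<and>
        utility b \<pi>0 e < utility b \<pi>0 t"
      by (intro eventually_conj eventually_admissible_zero eventually_at_right_less)
    then obtain e where e: "0 < e" "e < t" "e \<in> admissible W w0 S \<pi>0"
        "utility b \<pi>0 e < utility b \<pi>0 t"
      using eventually_happens'[OF trivial_limit_at_right_real] by blast
    have "\<forall>\<^sub>F \<pi> in at_right \<pi>0. 0 < utility b \<pi> t - utility b \<pi> e"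
    proof (rule order_tendstoD(1))
      show "((\<lambda>\<pi>. utility b \<pi> t - utility b \<pi> e) \<longlongrightarrow> utility b \<pi>0 t - utility b \<pi>0 e) (at_right \<pi>0)"
        by (intro tendsto_diff tendsto_utility[OF t(2)] tendsto_utility[OF e(3)]) auto
    qed (use e(4) in simp)
    moreover have "\<forall>\<^sub>F \<pi> in at_right \<pi>0. t \<in> admissible W w0 S \<pi>"
      by (rule eventually_admissible[OF t(2)]) auto
    moreover have "\<forall>\<^sub>F \<pi> in at_right \<pi>0. \<pi>0 < \<pi> \<and> \<pi> \<le> \<pi>1"
      using less by (auto simp: eventually_at_right_field)
    ultimately have "\<forall>\<^sub>F \<pi> in at_right \<pi>0. e < \<theta> k \<pi>"
    proof eventually_elim
      case (elim \<pi>)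
      then have max: "is_arg_max (utility b \<pi>) (\<lambda>\<theta>. \<theta> \<in> admissible W w0 S \<pi>) (\<theta> k \<pi>)"
        using \<theta>_mem[of \<pi> k] I(2) seeking_argmax[of \<pi>] by auto
      have adm: "\<theta> k \<pi> \<in> admissible W w0 S \<pi>" using max by (auto simp: is_arg_max_def)
      have ge: "utility b \<pi> t \<le> utility b \<pi> (\<theta> k \<pi>)"
        using max elim by (auto simp: is_arg_max_def not_less)
      show ?case
      proof (rule ccontr)
        assume "\<not> e < \<theta> k \<pi>"
        then consider "\<theta> k \<pi> = e" | "\<theta> k \<pi> < e" by linarith
        then show False
        proof cases
          case 1
          then show ?thesis using ge elim(1) by simp
        next
          case 2
          have "min (utility b \<pi> (\<theta> k \<pi>)) (utility b \<pi> t) < utility b \<pi> e"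
            using elim \<pi>0_lo \<pi>1_hi 2 e by (intro utility_quasiconcave[OF b] adm) auto
          then show ?thesis using ge elim(1) by auto
        qed
      qed
    qed
    then show ?thesis using e by blast
  qed
  then obtain e where e: "0 < e" "\<forall>\<^sub>F \<pi> in at_right \<pi>0. e < \<theta> k \<pi>" by blast

  define g where "g \<pi> = (\<Sum>i\<in>I - {k}. \<theta> i \<pi>)" for \<pi>
  have cont_g: "continuous_on {\<pi>0..\<pi>1} g"
    unfolding g_def[abs_def] by (intro continuous_on_sum cont_averse)
  have total: "(\<Sum>i\<in>I. \<theta> i \<pi>) = \<theta> k \<pi> + g \<pi>" for \<pi>
    using I by (simp add: g_def sum.remove)
  \<comment> \<open>As \<open>\<alpha> j\<close> is least, \<open>\<pi>0\<close> does not exceed the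
    upper mean payoff of any other averse investor.\<close>
  have "\<theta> i \<pi>0 = 0" if i: "i \<in> I - {k}" for i
  proof (rule averse_demand_zero)
    have "(2 * \<alpha> j - 1) * radius \<le> (2 * \<alpha> i - 1) * radius"
      using least[OF i] radius_pos by (intro mult_right_mono) auto
    then show "\<pi>0 \<le> mean (p0 hi + (2 * \<alpha> i - 1) * radius)"
      unfolding \<pi>0_def mean_le_iff by simp
  qed (use averse[OF i] i \<pi>0_ge \<theta>_mem[of \<pi>0 i] less in auto)
  then have g0: "g \<pi>0 = 0" by (simp add: g_def)
  \<comment> \<open>Just above \<open>\<pi>0\<close> the averse total exceeds \<open>- e\<close>
    while investor \<open>k\<close> holds more than \<open>e\<close>, so total demand is
    positive.\<close>
  have "(g \<longlongrightarrow> g \<pi>0) (at \<pi>0 within {\<pi>0..\<pi>1})"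
    using cont_g less by (simp add: continuous_on_def)
  then have "(g \<longlongrightarrow> 0) (at_right \<pi>0)"
    unfolding g0 at_within_Icc_at_right[OF less] .
  then have "\<forall>\<^sub>F \<pi> in at_right \<pi>0. - e < g \<pi>" using e(1) by (intro order_tendstoD(1)) auto
  then have "\<forall>\<^sub>F \<pi> in at_right \<pi>0. 0 < \<theta> k \<pi> + g \<pi> \<and> \<pi>0 < \<pi> \<and> \<pi> < \<pi>1"
    using e(2) eventually_at_right_real[OF less] by eventually_elim auto
  then obtain \<pi>2 where \<pi>2: "0 < \<theta> k \<pi>2 + g \<pi>2" "\<pi>0 < \<pi>2" "\<pi>2 < \<pi>1"
    using eventually_happens'[OF trivial_limit_at_right_real] by blast

  \<comment> \<open>At \<open>\<pi>1\<close> the price is the mean payoff under \<open>b\<close>, so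
    every nonzero position is worse than none by \<open>utility_less\<close>.\<close>
  have "\<theta> k \<pi>1 = 0"
  proof (rule ccontr)
    assume "\<theta> k \<pi>1 \<noteq> 0"
    have max: "is_arg_max (utility b \<pi>1) (\<lambda>\<theta>. \<theta> \<in> admissible W w0 S \<pi>1) (\<theta> k \<pi>1)"
      using \<theta>_mem[of \<pi>1 k] I(2) less seeking_argmax[of \<pi>1] by auto
    then have "utility b \<pi>1 (\<theta> k \<pi>1) < u w0"
      using \<open>\<theta> k \<pi>1 \<noteq> 0\<close> by (intro utility_less[OF b]) (auto simp: is_arg_max_def \<pi>1_def)
    then show False using max zero_admissible[of \<pi>1] by (auto simp: is_arg_max_def)
  qed
  \<comment> \<open>No averse investor is long at \<open>\<pi>1\<close>, and \<open>j\<close> is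
    strictly short because \<open>\<pi>1\<close> exceeds \<open>\<pi>0\<close>.\<close>
  moreover have "g \<pi>1 < 0"
  proof -
    have "\<theta> i \<pi>1 \<le> 0" if "i \<in> I - {k}" for i
      using averse_demand_nonpos[of "\<alpha> i" \<pi>1 "\<theta> i \<pi>1"] averse[OF that] that \<theta>_mem[of \<pi>1 i] less \<pi>0_ge
      by auto
    moreover have "\<theta> j \<pi>1 < 0"
      using averse_demand_neg[of "\<alpha> j" \<pi>1 "\<theta> j \<pi>1"] averse[OF j] j \<theta>_mem[of \<pi>1 j] less
      by (auto simp: \<pi>0_def)
    ultimately have "(\<Sum>i\<in>I - {k}. \<theta> i \<pi>1) < (\<Sum>i\<in>I - {k}. 0)"
      using j I(1) by (intro sum_strict_mono_ex1) auto
    then show ?thesis by (simp add: g_def)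
  qed
  ultimately have neg: "\<theta> k \<pi>1 + g \<pi>1 < 0" by simp
  \<comment> \<open>The interval starts at \<open>\<pi>2\<close> because continuity of
    \<open>\<theta> k\<close> is available only to the right of \<open>\<pi>0\<close>.\<close>
  have "continuous_on {\<pi>2..\<pi>1} (\<lambda>\<pi>. \<theta> k \<pi> + g \<pi>)"
    using \<pi>2 by (intro continuous_on_add continuous_on_subset[OF cont_seeking]
        continuous_on_subset[OF cont_g]) auto
  then obtain \<pi> where \<pi>: "\<pi>2 \<le> \<pi>" "\<pi> \<le> \<pi>1" "\<theta> k \<pi> + g \<pi> = 0"
    using IVT2'[of "\<lambda>\<pi>. \<theta> k \<pi> + g \<pi>" \<pi>1 0 \<pi>2] \<pi>2 neg by auto
  have "\<pi> \<noteq> \<pi>1" using \<pi>(3) neg by auto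
  then have range: "\<pi>0 < \<pi>" "\<pi> < \<pi>1" using \<pi> \<pi>2 by auto
  \<comment> \<open>The root lies strictly below \<open>\<pi>1\<close>, where holding nothing is not
    optimal for investor \<open>k\<close>.\<close>
  have "\<theta> k \<pi> \<noteq> 0"
  proof
    assume "\<theta> k \<pi> = 0"
    then have "is_arg_max (utility b \<pi>) (\<lambda>\<theta>. \<theta> \<in> admissible W w0 S \<pi>) 0"
      using \<theta>_mem[of \<pi> k] I(2) range seeking_argmax[of \<pi>] by auto
    then show False using better_right[OF range(2)] by (auto simp: is_arg_max_def)
  qed
  then have "nonzero_second_best_equilibrium_price W u w0 p0 c S I \<alpha> 0 \<pi>"
    unfolding nonzero_second_best_equilibrium_price_def second_best_positions_def
    using singleton[of \<pi>] range total[of \<pi>] \<pi>(3) I(2)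
    by (intro exI[of _ "\<lambda>i. \<theta> i \<pi>"]) auto
  then show ?thesis using range \<pi>0_lo \<pi>1_hi by (intro exI[of _ \<pi>]) auto
qed

end

text \<open>Naming the states by their payoffs turns the hypotheses into those of
  \<open>two_state_market\<close>. Investor 1 serves as \<open>k\<close>, and an investor attaining
  the minimum of the other coefficients serves as \<open>j\<close>.\<close>

theorem corollary3p5:
  fixes p0 S :: "'s::finite \<Rightarrow> real"
    and u :: "real \<Rightarrow> real" and W :: "real set"
    and w0 c :: real
    and m :: nat and \<alpha> :: "nat \<Rightarrow> real"
  assumes two_states: "CARD('s) = 2"
    and nonconstant: "\<exists>s t. S s \<noteq> S t"
    and p0_pos: "\<forall>s. p0 s > 0"
    and p0_sum: "(\<Sum>s\<in>UNIV. p0 s) = 1"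
    and c_lower: "c > 1"
    and c_upper: "c < Min (range (\<lambda>s. 1 / (1 - p0 s)))"
    and wealth: "W = UNIV \<or> (W = {0<..} \<and> w0 > 0)"
    and u_concave: "strictly_concave_on W u"
    and u_diff: "u differentiable_on W"
    and u_diff2: "deriv u differentiable_on W"
    and u_increasing_at_w0: "deriv u w0 > 0"
    and investors: "m \<ge> 2"
    and \<alpha>_range: "\<forall>i\<in>{1..m}. 0 \<le> \<alpha> i \<and> \<alpha> i \<le> 1"
    and \<alpha>_1: "\<alpha> 1 < 1/2"
    and \<alpha>_others: "\<forall>i\<in>{1..m} - {1}. \<alpha> i \<ge> 1/2"
    and demands: "demands_exist W u w0 p0 c S {1..m} \<alpha>"
    and condition: "\<alpha> 1 + Min (\<alpha> ` ({1..m} - {1})) < 1"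
  shows "\<exists>\<pi>. Min (range S) < \<pi> \<and> \<pi> < Max (range S) \<and>
           nonzero_second_best_equilibrium_price W u w0 p0 c S {1..m} \<alpha> 0 \<pi>"
proof -
  obtain a b :: 's where ab: "UNIV = {a, b}" "a \<noteq> b"
    using two_states by (meson card_2_iff)
  have "S a \<noteq> S b" using nonconstant ab(1) by (metis UNIV_I insertE singletonD)
  then obtain lo hi where states: "UNIV = {lo, hi}" and S_less: "S lo < S hi"
    using ab(1) by (metis insert_commute linorder_neqE_linordered_idom)
  have "range S = {S lo, S hi}" unfolding states by simp
  then have Min_S: "Min (range S) = S lo" and Max_S: "Max (range S) = S hi"
    using S_less by (auto simp: min_def max_def)
  interpret two_state_market p0 S u W w0 c lo hi
  proof
    have "lo \<noteq> hi" using S_less by auto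
    then show "p0 lo + p0 hi = 1" using p0_sum unfolding states by simp
    show "c < 1 / (1 - p0 lo)" "c < 1 / (1 - p0 hi)" using c_upper by auto
    show "open W" "convex W" "w0 \<in> W" using wealth by auto
  qed (use states S_less p0_pos c_lower u_concave u_diff u_increasing_at_w0 in auto)
  have "2 \<in> {1..m} - {1}" using investors by simp
  then have "\<alpha> ` ({1..m} - {1}) \<noteq> {}" by blast
  then have "Min (\<alpha> ` ({1..m} - {1})) \<in> \<alpha> ` ({1..m} - {1})" by (intro Min_in) auto
  then obtain j where j: "j \<in> {1..m} - {1}" "Min (\<alpha> ` ({1..m} - {1})) = \<alpha> j"
    by blast
  have least: "\<alpha> j \<le> \<alpha> i" if "i \<in> {1..m} - {1}" for i
    unfolding j(2)[symmetric] using that by (intro Min_le) auto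
  show ?thesis
    unfolding Min_S Max_S
  proof (rule nonzero_equilibrium_exists[where k = 1 and j = j])
    show "second_best_demand W u w0 p0 c S (\<alpha> i) \<pi> \<noteq> {}"
      if "S lo < \<pi>" "\<pi> < S hi" "i \<in> {1..m}" for \<pi> i
      using demands that unfolding demands_exist_def Min_S Max_S by blast
  qed (use j condition least \<alpha>_range \<alpha>_1 \<alpha>_others investors in auto)
qed

end
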